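(* Let $G=(V,E)$ be a graph with $V=[n]$ and $|E|=m$. For any $A\subset[n]$, let $\phi(A)$ be the number of edges in the subgraph $G|_A$ of $G$ induced by $A$. Then any $x=(x_1,\ldots,x_n)\in\mathbb{R}^n$ is the mean score sequence of a random tournament on $G$ if and only if $\sum_{i=1}^n x_i=m$ and $\sum_{i\in A}x_i\ge\phi(A)$ for all $A\subset[n]$.
   Context: Here $[n]=\{1,\ldots,n\}$. Graphs are finite, undirected and simple (no loops or multiple edges); each edge is written $(i,j)$ with $i<j$ when an order of its endpoints is needed. A random tournament on $G=(V,E)$ is a collection of real numbers $p_{ij}\in[0,1]$, one for each edge $(i,j)\in E$ with $i<j$ ($p_{ij}$ is interpreted as the probability that team $i$ beats team $j$, and $1-p_{ij}$ as the probability that $j$ beats $i$). The mean score sequence $x=(x_1,\ldots,x_n)$ of a random tournament is given by $$x_i=\sum_{\substack{j>i\\(i,j)\in E}}p_{ij}+\sum_{\substack{j<i\\(i,j)\in E}}(1-p_{ji}),$$ where in the second sum $(i,j)\in E$ means that the edge joining $j$ and $i$ belongs to $E$. *)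

theory Defs
  imports Complex_Main
begin

text \<open>Edges are unordered, represented as two-element sets of vertices.\<close>

definition simple_graph :: "'a set \<Rightarrow> 'a set set \<Rightarrow> bool" where
  "simple_graph V E \<longleftrightarrow> finite V \<and> (\<forall>e\<in>E. e \<subseteq> V \<and> card e = 2)"

definition induced_edges :: "'a set set \<Rightarrow> 'a set \<Rightarrow> 'a set set" where
  "induced_edges E A = {e \<in> E. e \<subseteq> A}"

text \<open>A tournament is given by a function on all pairs; only its values \<open>p i j\<close> at edges
  \<open>{i, j}\<close> with \<open>i < j\<close> are constrained here or used below.\<close>

definition random_tournament :: "nat set set \<Rightarrow> (nat \<Rightarrow> nat \<Rightarrow> real) \<Rightarrow> bool" where
  "random_tournament E p \<longleftrightarrow> (\<forall>i j. i < j \<and> {i, j} \<in> E \<longrightarrow> p i j \<in> {0..1})"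

definition mean_score :: "nat set set \<Rightarrow> (nat \<Rightarrow> nat \<Rightarrow> real) \<Rightarrow> nat \<Rightarrow> real" where
  "mean_score E p i =
     (\<Sum>j | j > i \<and> {i, j} \<in> E. p i j) + (\<Sum>j | j < i \<and> {i, j} \<in> E. 1 - p j i)"

text \<open>A vector indexed by \<open>V\<close> is a function whose values outside \<open>V\<close> are irrelevant.\<close>

definition mean_score_sequence ::
  "nat set \<Rightarrow> nat set set \<Rightarrow> (nat \<Rightarrow> nat \<Rightarrow> real) \<Rightarrow> (nat \<Rightarrow> real) \<Rightarrow> bool" where
  "mean_score_sequence V E p x \<longleftrightarrow> (\<forall>i\<in>V. x i = mean_score E p i)"

end

theory Submission
  imports Defs
begin

text \<open>
  A random tournament splits one point per edge between the two endpoints of that edge, and a mean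
  score is the total of the shares that a vertex receives. The inequalities are necessary because
  all the points of the edges inside \<open>A\<close> must be received in \<open>A\<close>.

  For the converse, call \<open>f A = (\<Sum>i\<in>A. x i) - \<phi> A\<close> the slack of \<open>A\<close>, and remove an edge
  \<open>{u, v}\<close>, paying \<open>t\<close> to \<open>u\<close> and \<open>1 - t\<close> to \<open>v\<close>. The slack of a set that contains both or neither
  of \<open>u\<close>, \<open>v\<close> does not change, so the inequalities survive iff \<open>t \<le> f A\<close> whenever \<open>A\<close> contains \<open>u\<close>
  but not \<open>v\<close>, and \<open>1 - t \<le> f B\<close> whenever \<open>B\<close> contains \<open>v\<close> but not \<open>u\<close>. Such a \<open>t\<close> in \<open>[0, 1]\<close> exists because
  \<open>f A + f B \<ge> 1\<close> for all such \<open>A\<close>, \<open>B\<close>: the count of induced edges is supermodular, and the edge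
  \<open>{u, v}\<close> lies inside \<open>A \<union> B\<close> but inside neither \<open>A\<close> nor \<open>B\<close>, which supplies the extra unit
  (\<open>card_induced_edges_crossing\<close>, \<open>edge_split_exists\<close>). Induction on the edge set then pays out
  all of \<open>x\<close> (\<open>edge_sharing_exists\<close>).
\<close>

section \<open>Sharing one point per edge\<close>

definition edge_sharing :: "'a set set \<Rightarrow> ('a set \<Rightarrow> 'a \<Rightarrow> real) \<Rightarrow> bool" where
  "edge_sharing E w \<longleftrightarrow> (\<forall>e\<in>E. (\<forall>v\<in>e. 0 \<le> w e v) \<and> (\<Sum>v\<in>e. w e v) = 1)"

definition total_share :: "'a set set \<Rightarrow> ('a set \<Rightarrow> 'a \<Rightarrow> real) \<Rightarrow> 'a \<Rightarrow> real" where
  "total_share E w v = (\<Sum>e | e \<in> E \<and> v \<in> e. w e v)"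

lemma finite_simple_graph_edges:
  assumes "simple_graph V E"
  shows "finite E"
proof (rule finite_subset)
  show "E \<subseteq> Pow V" "finite (Pow V)"
    using assms by (auto simp: simple_graph_def)
qed

lemma simple_graph_edge_cases:
  assumes "simple_graph V E" "e \<in> E"
  obtains u v where "e = {u, v}" "u \<noteq> v" "u \<in> V" "v \<in> V"
proof -
  have "e \<subseteq> V" "card e = 2"
    using assms by (auto simp: simple_graph_def)
  then show thesis
    using that by (auto simp: card_2_iff)
qed

lemma sum_total_share:
  assumes "finite E" "finite A"
  shows "(\<Sum>v\<in>A. total_share E w v) = (\<Sum>e\<in>E. \<Sum>v\<in>A \<inter> e. w e v)"
proof -
  have "(\<Sum>v\<in>A. total_share E w v) = (\<Sum>v\<in>A. \<Sum>e\<in>E. if v \<in> e then w e v else 0)"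
    unfolding total_share_def using assms by (simp add: sum.inter_filter)
  also have "\<dots> = (\<Sum>e\<in>E. \<Sum>v\<in>A. if v \<in> e then w e v else 0)"
    by (rule sum.swap)
  also have "\<dots> = (\<Sum>e\<in>E. \<Sum>v\<in>A \<inter> e. w e v)"
    using assms by (simp add: sum.inter_restrict)
  finally show ?thesis .
qed

lemma sum_total_share_ge_card_induced_edges:
  assumes "finite E" "finite A" "edge_sharing E w"
  shows "(\<Sum>v\<in>A. total_share E w v) \<ge> real (card (induced_edges E A))"
proof -
  have "real (card (induced_edges E A)) = (\<Sum>e\<in>E. if e \<subseteq> A then 1 else 0)"
    using assms(1) by (simp add: induced_edges_def sum.inter_filter[symmetric])
  also have "\<dots> \<le> (\<Sum>e\<in>E. \<Sum>v\<in>A \<inter> e. w e v)"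
  proof (rule sum_mono)
    fix e assume e: "e \<in> E"
    have "0 \<le> (\<Sum>v\<in>A \<inter> e. w e v)"
      using assms(3) e by (intro sum_nonneg) (auto simp: edge_sharing_def)
    moreover have "(\<Sum>v\<in>A \<inter> e. w e v) = 1" if "e \<subseteq> A"
      using that assms(3) e by (simp add: edge_sharing_def Int_absorb1)
    ultimately show "(if e \<subseteq> A then 1 else 0) \<le> (\<Sum>v\<in>A \<inter> e. w e v)"
      by simp
  qed
  finally show ?thesis
    using assms by (simp add: sum_total_share)
qed

lemma sum_total_share_eq_card_edges:
  assumes "finite E" "finite V" "edge_sharing E w" "\<And>e. e \<in> E \<Longrightarrow> e \<subseteq> V"
  shows "(\<Sum>v\<in>V. total_share E w v) = real (card E)"
  using assms by (simp add: sum_total_share edge_sharing_def Int_absorb1)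

section \<open>Splitting the point of one edge\<close>

lemma card_induced_edges_insert:
  assumes "finite E" "e \<notin> E"
  shows "card (induced_edges (insert e E) A) = card (induced_edges E A) + (if e \<subseteq> A then 1 else 0)"
proof -
  have "induced_edges (insert e E) A =
    (if e \<subseteq> A then insert e (induced_edges E A) else induced_edges E A)"
    by (auto simp: induced_edges_def)
  then show ?thesis
    using assms by (simp add: induced_edges_def)
qed

text \<open>An edge inside \<open>A\<close> or inside \<open>B\<close> is inside \<open>A \<union> B\<close>, and it is counted twice on the left
  only if it is inside \<open>A \<inter> B\<close>; the crossing edge \<open>e\<close> accounts for the extra unit.\<close>

lemma card_induced_edges_crossing:
  assumes "finite E" "e \<in> E" "e \<subseteq> A \<union> B" "\<not> e \<subseteq> A" "\<not> e \<subseteq> B"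
  shows "card (induced_edges E A) + card (induced_edges E B) + 1
    \<le> card (induced_edges E (A \<union> B)) + card (induced_edges E (A \<inter> B))"
proof -
  let ?i = "induced_edges E"
  have fin: "finite (?i X)" for X
    using assms(1) by (simp add: induced_edges_def)
  have "card (?i A) + card (?i B) = card (?i A \<union> ?i B) + card (?i A \<inter> ?i B)"
    using fin by (intro card_Un_Int)
  moreover have "?i A \<inter> ?i B = ?i (A \<inter> B)"
    by (auto simp: induced_edges_def)
  moreover have "card (?i A \<union> ?i B) < card (?i (A \<union> B))"
    using assms fin by (intro psubset_card_mono) (auto simp: induced_edges_def)
  ultimately show ?thesis
    by simp
qed

text \<open>The share of \<open>u\<close> can be taken as large as the sets on the side of \<open>u\<close> allow, but at most \<open>1\<close>.\<close>

lemma edge_split_exists: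
  assumes V: "finite V" and E: "finite E" and e: "{u, v} \<in> E" "u \<in> V" "v \<in> V" "u \<noteq> v"
    and ineq: "\<And>A. A \<subseteq> V \<Longrightarrow> real (card (induced_edges E A)) \<le> sum x A"
  obtains t :: real where "0 \<le> t" "t \<le> 1"
    "\<And>A. \<lbrakk>A \<subseteq> V; u \<in> A; v \<notin> A\<rbrakk> \<Longrightarrow> real (card (induced_edges E A)) + t \<le> sum x A"
    "\<And>B. \<lbrakk>B \<subseteq> V; v \<in> B; u \<notin> B\<rbrakk> \<Longrightarrow> real (card (induced_edges E B)) + (1 - t) \<le> sum x B"
proof
  define f where "f A = sum x A - real (card (induced_edges E A))" for A
  define U where "U = {A. A \<subseteq> V \<and> u \<in> A \<and> v \<notin> A}"
  define t where "t = Min (insert 1 (f ` U))"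
  have nonneg: "0 \<le> f A" if "A \<subseteq> V" for A
    using ineq[OF that] by (simp add: f_def)
  have "finite U"
    unfolding U_def using V by simp
  then have fin: "finite (insert 1 (f ` U))"
    by simp
  show "0 \<le> t"
    unfolding t_def using fin nonneg by (auto simp: U_def)
  show "t \<le> 1"
    unfolding t_def using fin by simp
  show "real (card (induced_edges E A)) + t \<le> sum x A" if "A \<subseteq> V" "u \<in> A" "v \<notin> A" for A
  proof -
    have "t \<le> f A"
      unfolding t_def using that fin by (intro Min_le) (auto simp: U_def)
    then show ?thesis
      by (simp add: f_def)
  qed
  show "real (card (induced_edges E B)) + (1 - t) \<le> sum x B" if B: "B \<subseteq> V" "v \<in> B" "u \<notin> B" for B
  proof -
    have crossing: "1 \<le> f A + f B" if A: "A \<in> U" for A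
    proof -
      have AV: "A \<subseteq> V"
        using A by (simp add: U_def)
      have "card (induced_edges E A) + card (induced_edges E B) + 1
          \<le> card (induced_edges E (A \<union> B)) + card (induced_edges E (A \<inter> B))"
        using A B by (intro card_induced_edges_crossing[OF E e(1)]) (auto simp: U_def)
      moreover have "sum x A + sum x B = sum x (A \<union> B) + sum x (A \<inter> B)"
        using AV B(1) V by (intro sum.union_inter[symmetric]) (auto intro: finite_subset)
      ultimately have "f (A \<union> B) + f (A \<inter> B) + 1 \<le> f A + f B"
        by (simp add: f_def)
      moreover have "0 \<le> f (A \<union> B)" "0 \<le> f (A \<inter> B)"
        using AV B(1) by (auto intro: nonneg)
      ultimately show ?thesis
        by simp
    qed
    have "t \<in> insert 1 (f ` U)"
      unfolding t_def using fin by (intro Min_in) auto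
    then have "1 \<le> t + f B"
      using crossing nonneg[OF B(1)] by auto
    then show ?thesis
      by (simp add: f_def)
  qed
qed

section \<open>Realizing a vector by an edge sharing\<close>

text \<open>Paying out the point of an edge lowers both the total of \<open>x\<close> and the number of edges by one,
  so the equality on \<open>V\<close> persists as edges are removed; without edges, it forces the vector \<open>x\<close>,
  nonnegative by the singleton inequalities, to vanish on \<open>V\<close>.\<close>

lemma edge_sharing_exists:
  assumes "finite V" "finite E" "simple_graph V E"
    and "sum x V = real (card E)"
    and "\<And>A. A \<subseteq> V \<Longrightarrow> real (card (induced_edges E A)) \<le> sum x A"
  shows "\<exists>w. edge_sharing E w \<and> (\<forall>v\<in>V. x v = total_share E w v)"
  using assms(2-)
proof (induction E arbitrary: x rule: finite_induct)
  case empty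
  have "0 \<le> x v" if "v \<in> V" for v
    using empty.prems(3)[of "{v}"] that by (simp add: induced_edges_def)
  then have "\<forall>v\<in>V. x v = 0"
    using empty.prems(2) sum_nonneg_eq_0_iff[OF assms(1), of x] by simp
  then show ?case
    by (simp add: edge_sharing_def total_share_def)
next
  case (insert e E)
  obtain u v where uv: "e = {u, v}" "u \<noteq> v" "u \<in> V" "v \<in> V"
    using insert.prems(1) by (rule simple_graph_edge_cases[of V "insert e E" e]) auto
  obtain t where t: "0 \<le> t" "t \<le> 1"
    "\<And>A. \<lbrakk>A \<subseteq> V; u \<in> A; v \<notin> A\<rbrakk> \<Longrightarrow> real (card (induced_edges (insert e E) A)) + t \<le> sum x A"
    "\<And>B. \<lbrakk>B \<subseteq> V; v \<in> B; u \<notin> B\<rbrakk> \<Longrightarrow> real (card (induced_edges (insert e E) B)) + (1 - t) \<le> sum x B"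
    using edge_split_exists[of V "insert e E" u v x] assms(1) insert.hyps(1) insert.prems(3) uv
    by blast
  define s where "s = (\<lambda>i. if i = u then t else if i = v then 1 - t else 0)"
  have sum_s: "sum s A = (if u \<in> A then t else 0) + (if v \<in> A then 1 - t else 0)"
    if "A \<subseteq> V" for A
  proof -
    have "finite A"
      using that assms(1) by (rule finite_subset)
    moreover have "sum s A = (\<Sum>i\<in>A. (if i = u then t else 0) + (if i = v then 1 - t else 0))"
      using uv(2) by (intro sum.cong) (auto simp: s_def)
    ultimately show ?thesis
      by (simp add: sum.distrib)
  qed
  have "\<exists>w. edge_sharing E w \<and> (\<forall>i\<in>V. x i - s i = total_share E w i)"
  proof (rule insert.IH)
    show "simple_graph V E"
      using insert.prems(1) by (simp add: simple_graph_def)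
    show "(\<Sum>i\<in>V. x i - s i) = real (card E)"
      using insert.prems(2) insert.hyps uv by (simp add: sum_subtractf sum_s)
    fix A assume A: "A \<subseteq> V"
    have card: "card (induced_edges (insert e E) A)
        = card (induced_edges E A) + (if u \<in> A \<and> v \<in> A then 1 else 0)"
      using card_induced_edges_insert[OF insert.hyps, of A] uv(1) by simp
    show "real (card (induced_edges E A)) \<le> (\<Sum>i\<in>A. x i - s i)"
      using insert.prems(3)[OF A] t(3,4)[OF A] card
      by (cases "u \<in> A"; cases "v \<in> A") (simp_all add: sum_subtractf sum_s[OF A])
  qed
  then obtain w where w: "edge_sharing E w" "\<And>i. i \<in> V \<Longrightarrow> x i - s i = total_share E w i"
    by blast
  define w' where "w' = w(e := s)"
  have w'_E: "w' d = w d" if "d \<in> E" for d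
    using that insert.hyps(2) by (auto simp: w'_def)
  have "edge_sharing (insert e E) w'"
    using w(1) t(1,2) uv(1,2) w'_E by (auto simp: edge_sharing_def w'_def s_def)
  moreover have "x i = total_share (insert e E) w' i" if "i \<in> V" for i
  proof -
    have split: "{d. d \<in> insert e E \<and> i \<in> d} =
        (if i \<in> e then insert e {d. d \<in> E \<and> i \<in> d} else {d. d \<in> E \<and> i \<in> d})"
      by auto
    have "(\<Sum>d | d \<in> E \<and> i \<in> d. w' d i) = total_share E w i"
      unfolding total_share_def using w'_E by (intro sum.cong) auto
    moreover have "w' e i = s i" "i \<notin> e \<Longrightarrow> s i = 0"
      using uv(1) by (auto simp: w'_def s_def)
    ultimately have "total_share (insert e E) w' i = s i + total_share E w i"
      unfolding total_share_def[of "insert e E"] split using insert.hyps by simp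
    then show ?thesis
      using w(2)[OF that] by simp
  qed
  ultimately show ?case
    by blast
qed

section \<open>Tournaments as edge sharings\<close>

text \<open>The neighbours \<open>j\<close> of \<open>i\<close> correspond bijectively to the edges \<open>{i, j}\<close> at \<open>i\<close>; the two sums
  in the mean score are the edges on which \<open>i\<close> is the smaller or the larger endpoint.\<close>

lemma mean_score_eq_total_share:
  assumes "simple_graph V E"
    and shares: "\<And>i j. \<lbrakk>i < j; {i, j} \<in> E\<rbrakk> \<Longrightarrow> w {i, j} i = p i j \<and> w {i, j} j = 1 - p i j"
  shows "mean_score E p i = total_share E w i"
proof -
  let ?up = "{j. j > i \<and> {i, j} \<in> E}" and ?down = "{j. j < i \<and> {i, j} \<in> E}"
  have "?up \<union> ?down \<subseteq> V" "finite V"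
    using assms(1) by (auto simp: simple_graph_def)
  then have fin: "finite ?up" "finite ?down"
    by (auto dest: finite_subset)
  have inj: "inj_on (\<lambda>j. {i, j}) (?up \<union> ?down)"
    by (auto simp: inj_on_def doubleton_eq_iff)
  have edges: "{e. e \<in> E \<and> i \<in> e} = (\<lambda>j. {i, j}) ` (?up \<union> ?down)"
  proof (intro equalityI subsetI)
    fix e assume "e \<in> {e. e \<in> E \<and> i \<in> e}"
    then have e: "e \<in> E" "i \<in> e"
      by auto
    obtain a b where "e = {a, b}" "a \<noteq> b"
      using simple_graph_edge_cases[OF assms(1) e(1)] .
    then obtain j where "e = {i, j}" "j \<noteq> i"
      using e(2) by (auto simp: insert_commute)
    then show "e \<in> (\<lambda>j. {i, j}) ` (?up \<union> ?down)"
      using e(1) by (auto simp: neq_iff)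
  qed auto
  have "total_share E w i = (\<Sum>j\<in>?up \<union> ?down. w {i, j} i)"
    unfolding total_share_def edges using inj by (simp add: sum.reindex)
  also have "\<dots> = (\<Sum>j\<in>?up. w {i, j} i) + (\<Sum>j\<in>?down. w {i, j} i)"
    using fin by (intro sum.union_disjoint) auto
  also have "(\<Sum>j\<in>?up. w {i, j} i) = (\<Sum>j\<in>?up. p i j)"
    using shares by (intro sum.cong) auto
  also have "(\<Sum>j\<in>?down. w {i, j} i) = (\<Sum>j\<in>?down. 1 - p j i)"
    using shares by (intro sum.cong) (auto simp: insert_commute)
  finally show ?thesis
    by (simp add: mean_score_def)
qed

lemma simple_graph_edge_ordered_cases:
  fixes e :: "nat set"
  assumes "simple_graph V E" "e \<in> E"
  obtains i j where "e = {i, j}" "i < j"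
proof -
  obtain a b where "e = {a, b}" "a \<noteq> b"
    using simple_graph_edge_cases[OF assms] .
  then show thesis
    using that[of a b] that[of b a] by (cases "a < b") (auto simp: insert_commute)
qed

lemma mean_score_sequence_iff_edge_sharing:
  assumes G: "simple_graph V E"
  shows "(\<exists>p. random_tournament E p \<and> mean_score_sequence V E p x) \<longleftrightarrow>
    (\<exists>w. edge_sharing E w \<and> (\<forall>v\<in>V. x v = total_share E w v))"
proof
  assume "\<exists>p. random_tournament E p \<and> mean_score_sequence V E p x"
  then obtain p where p: "random_tournament E p" "mean_score_sequence V E p x"
    by blast
  define w where "w e v = (let q = p (Min e) (Max e) in if v = Min e then q else 1 - q)" for e v
  have w: "w {i, j} i = p i j \<and> w {i, j} j = 1 - p i j" if "i < j" for i j
    using that by (simp add: w_def)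
  have "edge_sharing E w"
    unfolding edge_sharing_def
  proof
    fix e assume "e \<in> E"
    moreover obtain i j where "e = {i, j}" "i < j"
      using simple_graph_edge_ordered_cases[OF G \<open>e \<in> E\<close>] .
    ultimately show "(\<forall>v\<in>e. 0 \<le> w e v) \<and> (\<Sum>v\<in>e. w e v) = 1"
      using p(1) w[of i j] by (auto simp: random_tournament_def)
  qed
  moreover have "\<forall>v\<in>V. x v = total_share E w v"
    using p(2) mean_score_eq_total_share[OF G, of w p] w by (simp add: mean_score_sequence_def)
  ultimately show "\<exists>w. edge_sharing E w \<and> (\<forall>v\<in>V. x v = total_share E w v)"
    by blast
next
  assume "\<exists>w. edge_sharing E w \<and> (\<forall>v\<in>V. x v = total_share E w v)"
  then obtain w where w: "edge_sharing E w" "\<forall>v\<in>V. x v = total_share E w v"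
    by blast
  define p where "p i j = w {i, j} i" for i j
  have shares: "0 \<le> w {i, j} i" "0 \<le> w {i, j} j" "w {i, j} i + w {i, j} j = 1"
    if "i < j" "{i, j} \<in> E" for i j
  proof -
    have "\<forall>v\<in>{i, j}. 0 \<le> w {i, j} v" "(\<Sum>v\<in>{i, j}. w {i, j} v) = 1"
      using w(1) that(2) by (auto simp: edge_sharing_def)
    then show "0 \<le> w {i, j} i" "0 \<le> w {i, j} j" "w {i, j} i + w {i, j} j = 1"
      using that(1) by auto
  qed
  have "random_tournament E p"
    unfolding random_tournament_def
  proof (intro allI impI, elim conjE)
    fix i j :: nat assume "i < j" "{i, j} \<in> E"
    from shares[OF this] show "p i j \<in> {0..1}"
      by (simp add: p_def)
  qed
  moreover have "mean_score E p i = total_share E w i" for i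
    using shares(3) by (intro mean_score_eq_total_share[OF G]) (simp add: p_def eq_diff_eq add.commute)
  ultimately show "\<exists>p. random_tournament E p \<and> mean_score_sequence V E p x"
    using w(2) by (auto simp: mean_score_sequence_def)
qed

section \<open>Characterization of mean score sequences\<close>

theorem theorem4:
  fixes n m :: nat and E :: "nat set set" and \<phi> :: "nat set \<Rightarrow> nat" and x :: "nat \<Rightarrow> real"
  assumes "simple_graph {1..n} E"
    and "card E = m"
    and "\<And>A. A \<subseteq> {1..n} \<Longrightarrow> \<phi> A = card (induced_edges E A)"
  shows "(\<exists>p. random_tournament E p \<and> mean_score_sequence {1..n} E p x) \<longleftrightarrow>
    (\<Sum>i=1..n. x i) = real m \<and> (\<forall>A. A \<subseteq> {1..n} \<longrightarrow> (\<Sum>i\<in>A. x i) \<ge> real (\<phi> A))"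
  unfolding mean_score_sequence_iff_edge_sharing[OF assms(1)]
proof
  have fin: "finite E"
    using assms(1) by (rule finite_simple_graph_edges)
  assume "\<exists>w. edge_sharing E w \<and> (\<forall>v\<in>{1..n}. x v = total_share E w v)"
  then obtain w where w: "edge_sharing E w" "\<And>v. v \<in> {1..n} \<Longrightarrow> x v = total_share E w v"
    by blast
  have sum_x: "sum x A = (\<Sum>v\<in>A. total_share E w v)" if "A \<subseteq> {1..n}" for A
    using that w(2) by (intro sum.cong) auto
  have "(\<Sum>i=1..n. x i) = real m"
    using sum_total_share_eq_card_edges[OF fin _ w(1)] assms(1,2)
    by (simp add: sum_x simple_graph_def)
  moreover have "real (\<phi> A) \<le> sum x A" if "A \<subseteq> {1..n}" for A
    using sum_total_share_ge_card_induced_edges[OF fin _ w(1)] finite_subset[OF that]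
    by (simp add: sum_x[OF that] assms(3)[OF that])
  ultimately show "(\<Sum>i=1..n. x i) = real m \<and> (\<forall>A. A \<subseteq> {1..n} \<longrightarrow> (\<Sum>i\<in>A. x i) \<ge> real (\<phi> A))"
    by blast
next
  assume "(\<Sum>i=1..n. x i) = real m \<and> (\<forall>A. A \<subseteq> {1..n} \<longrightarrow> (\<Sum>i\<in>A. x i) \<ge> real (\<phi> A))"
  then show "\<exists>w. edge_sharing E w \<and> (\<forall>v\<in>{1..n}. x v = total_share E w v)"
    using assms finite_simple_graph_edges[OF assms(1)]
    by (intro edge_sharing_exists) auto
qed

end
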